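(* Let $d\ge 2$. For any $\gamma>2$, $$\mathbb{P}\left(\delta_s(P_n,\mathbb{S}_e^+)\ge n^{-\gamma}\ \text{ for all but finitely many } n\right)=1,$$ where $P_n$ is the spherical convex hull of the first $n$ points of an independent sequence $X_1,X_2,\dots$ of uniformly distributed random points in the closed halfsphere $\mathbb{S}_e^+\subset\mathbb{S}^d$.
   Context: $d\ge 2$ is an integer; $\mathbb{S}^d$ is the unit sphere of $\mathbb{R}^{d+1}$ with standard scalar product $\langle\cdot,\cdot\rangle$; $\sigma$ is the spherical Lebesgue measure on $\mathbb{S}^d$ and $\omega_{d+1}=\sigma(\mathbb{S}^d)$. Fix $e\in\mathbb{S}^d$; $\mathbb{S}_e^+=\{u\in\mathbb{S}^d:\langle u,e\rangle\ge 0\}$, and $\mu=\frac{2}{\omega_{d+1}}\,\sigma$ restricted to $\mathbb{S}_e^+$ is the uniform probability measure on $\mathbb{S}_e^+$. $X_1,X_2,\dots$ is an independent sequence of random points in $\mathbb{S}_e^+$, each with distribution $\mu$, and $P_n=\mathrm{conv}_s\{X_1,\dots,X_n\}$, where $\mathrm{conv}_s(A)=\mathbb{S}^d\cap\mathrm{pos}\,A$ and $\mathrm{pos}$ denotes the positive hull in $\mathbb{R}^{d+1}$ (the set of all finite linear combinations with nonnegative coefficients). The spherical distance is $d_s(x,y)=\arccos\langle x,y\rangle$, and the spherical Hausdorff distance of nonempty compact $K,M\subset\mathbb{S}^d$ is $\delta_s(K,M)=\max\{\max_{x\in K}\min_{y\in M}d_s(x,y),\ \max_{x\in M}\min_{y\in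 K}d_s(x,y)\}$. *)

theory Defs
  imports "HOL-Probability.Probability"
begin

(* The standard formula sigma(A) = (d+1) * lambda {t x | 0 < t <= 1, x in A}, where d+1 is
   the dimension of the ambient space, phrased as an image measure under
   sgn x = x / norm x so that it is a measure on the Borel sets of the unit sphere by
   construction; emeasure_spherical_lebesgue below recovers the formula. *)
definition spherical_lebesgue :: "'a::euclidean_space measure" where
  "spherical_lebesgue =
     scale_measure (ennreal (real DIM('a)))
       (distr (restrict_space lborel (cball 0 1 - {0})) (restrict_space borel (sphere 0 1)) sgn)"

definition sphere_area :: "'a::euclidean_space itself \<Rightarrow> real" where
  "sphere_area _ = measure (spherical_lebesgue :: 'a measure) (sphere 0 1)"

definition halfsphere :: "'a::euclidean_space \<Rightarrow> 'a set" where
  "halfsphere e = {u \<in> sphere 0 1. u \<bullet> e \<ge> 0}"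

definition uniform_halfsphere :: "'a::euclidean_space \<Rightarrow> 'a measure" where
  "uniform_halfsphere e =
     scale_measure (ennreal (2 / sphere_area TYPE('a)))
       (restrict_space spherical_lebesgue (halfsphere e))"

definition pos_hull :: "'a::real_vector set \<Rightarrow> 'a set" where
  "pos_hull A = {\<Sum>x\<in>F. c x *\<^sub>R x | F c. finite F \<and> F \<subseteq> A \<and> (\<forall>x\<in>F. 0 \<le> c x)}"

definition spherical_hull :: "'a::euclidean_space set \<Rightarrow> 'a set" where
  "spherical_hull A = sphere 0 1 \<inter> pos_hull A"

definition spherical_dist :: "'a::euclidean_space \<Rightarrow> 'a \<Rightarrow> real" where
  "spherical_dist x y = arccos (x \<bullet> y)"

(* For nonempty compact K and M in the unit sphere every supremum and infimum is attained.
   For other arguments the value is not meaningful. *)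
definition spherical_hausdorff :: "'a::euclidean_space set \<Rightarrow> 'a set \<Rightarrow> real" where
  "spherical_hausdorff K M =
     max (SUP x\<in>K. INF y\<in>M. spherical_dist x y) (SUP x\<in>M. INF y\<in>K. spherical_dist x y)"

lemma sgn_measurable_sphere:
  "(sgn :: 'a::euclidean_space \<Rightarrow> 'a) \<in>
     restrict_space lborel (cball 0 1 - {0}) \<rightarrow>\<^sub>M restrict_space borel (sphere 0 1)"
proof (rule measurable_restrict_space2)
  show "(sgn :: 'a \<Rightarrow> 'a) \<in> space (restrict_space lborel (cball 0 1 - {0})) \<rightarrow> sphere 0 1"
    by (auto simp: space_restrict_space norm_sgn)
  have "(\<lambda>x::'a. inverse (norm x) *\<^sub>R x) \<in> borel_measurable borel"
    by measurable
  then show "(sgn :: 'a \<Rightarrow> 'a) \<in> restrict_space lborel (cball 0 1 - {0}) \<rightarrow>\<^sub>M borel"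
    by (intro measurable_restrict_space1) (simp add: sgn_div_norm[abs_def] divide_inverse)
qed

lemma sets_spherical_lebesgue [simp]:
  "sets (spherical_lebesgue :: 'a::euclidean_space measure) = sets (restrict_space borel (sphere 0 1))"
  by (simp add: spherical_lebesgue_def)

lemma space_spherical_lebesgue [simp]:
  "space (spherical_lebesgue :: 'a::euclidean_space measure) = sphere 0 1"
  by (simp add: spherical_lebesgue_def space_scale_measure space_restrict_space)

lemma cone_eq_sgn_vimage:
  assumes "A \<subseteq> sphere (0::'a::euclidean_space) 1"
  shows "{t *\<^sub>R x | t x. 0 < t \<and> t \<le> 1 \<and> x \<in> A} = sgn -` A \<inter> (cball 0 1 - {0})"
proof (intro equalityI subsetI)
  fix y assume "y \<in> sgn -` A \<inter> (cball 0 1 - {0})"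
  then have "y = norm y *\<^sub>R sgn y" "0 < norm y" "norm y \<le> 1" "sgn y \<in> A"
    by (auto simp: sgn_div_norm)
  then show "y \<in> {t *\<^sub>R x | t x. 0 < t \<and> t \<le> 1 \<and> x \<in> A}"
    by blast
next
  fix y assume "y \<in> {t *\<^sub>R x | t x. 0 < t \<and> t \<le> 1 \<and> x \<in> A}"
  then obtain t x where tx: "y = t *\<^sub>R x" "0 < t" "t \<le> 1" "x \<in> A"
    by blast
  moreover have "norm x = 1"
    using tx assms by auto
  ultimately show "y \<in> sgn -` A \<inter> (cball 0 1 - {0})"
    by (auto simp: sgn_div_norm)
qed

lemma emeasure_spherical_lebesgue:
  fixes A :: "'a::euclidean_space set"
  assumes A: "A \<in> sets spherical_lebesgue"
  shows "emeasure spherical_lebesgue A =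
           ennreal (real DIM('a)) * emeasure lborel {t *\<^sub>R x | t x. 0 < t \<and> t \<le> 1 \<and> x \<in> A}"
proof -
  have sub: "A \<subseteq> sphere 0 1"
    using sets.sets_into_space[OF A] by simp
  have "cball (0::'a) 1 - {0} \<in> sets borel"
    by simp
  then have "emeasure (restrict_space lborel (cball (0::'a) 1 - {0})) (sgn -` A \<inter> (cball 0 1 - {0}))
      = emeasure lborel (sgn -` A \<inter> (cball 0 1 - {0}))"
    by (intro emeasure_restrict_space) auto
  moreover have "space (restrict_space lborel (cball (0::'a) 1 - {0})) = cball 0 1 - {0}"
    by (simp add: space_restrict_space)
  ultimately show ?thesis
    using A by (simp add: spherical_lebesgue_def cone_eq_sgn_vimage[OF sub]
        emeasure_distr[OF sgn_measurable_sphere])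
qed

lemma halfsphere_sets: "halfsphere (e::'a::euclidean_space) \<in> sets spherical_lebesgue"
proof -
  have "halfsphere e = sphere 0 1 \<inter> {u. u \<bullet> e \<ge> 0}"
    by (auto simp: halfsphere_def)
  then show ?thesis
    by (auto simp: sets_restrict_space intro!: imageI)
qed

lemma prob_space_uniform_halfsphere:
  assumes e: "norm (e::'a::euclidean_space) = 1"
  shows "prob_space (uniform_halfsphere e)"
proof -
  define B :: "'a set" where "B = cball 0 1 - {0}"
  define H where "H = B \<inter> {u. u \<bullet> e \<ge> 0}"
  define H' where "H' = B \<inter> {u. u \<bullet> e \<le> 0}"
  define D where "D = ennreal (real DIM('a))"
  let ?C = "\<lambda>A. {t *\<^sub>R x | t x. 0 < t \<and> t \<le> 1 \<and> x \<in> A} :: 'a set"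
  have [measurable]: "B \<in> sets borel" "H \<in> sets borel" "H' \<in> sets borel"
    by (auto simp: B_def H_def H'_def)
  have cone_half: "?C (halfsphere e) = H"
    by (subst cone_eq_sgn_vimage)
       (auto simp: halfsphere_def H_def B_def sgn_div_norm zero_le_divide_iff zero_le_mult_iff)
  have cone_sphere: "?C (sphere 0 1) = B"
    by (subst cone_eq_sgn_vimage) (auto simp: B_def norm_sgn)
  have half: "emeasure spherical_lebesgue (halfsphere e) = D * emeasure lborel H"
    using emeasure_spherical_lebesgue[OF halfsphere_sets, of e] by (simp only: cone_half D_def)
  have "sphere 0 1 \<in> sets (spherical_lebesgue :: 'a measure)"
    by (metis sets.top space_spherical_lebesgue)
  from emeasure_spherical_lebesgue[OF this]
  have full: "emeasure spherical_lebesgue (sphere (0::'a) 1) = D * emeasure lborel B"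
    by (simp only: cone_sphere D_def)
  have bdd: "bounded B"
    unfolding B_def by (meson Diff_subset bounded_cball bounded_subset)
  have fin: "emeasure lborel A < \<infinity>" if "A \<subseteq> B" for A
    using emeasure_bounded_finite[OF bounded_subset[OF bdd that]] .
  have "measure lebesgue (uminus ` H) = measure lebesgue H"
    using measure_lebesgue_affine[of "-1" 0 H] by simp
  moreover have "uminus ` H = H'"
  proof -
    have "uminus ` H \<subseteq> H'" "uminus ` H' \<subseteq> H"
      by (auto simp: H_def H'_def B_def)
    then have "uminus ` uminus ` H' \<subseteq> uminus ` H"
      by (rule_tac image_mono)
    with \<open>uminus ` H \<subseteq> H'\<close> show ?thesis
      by (simp add: image_image)
  qed
  ultimately have eq: "measure lborel H' = measure lborel H"
    by simp
  have "negligible (H \<inter> H')"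
    by (rule negligible_subset[OF negligible_hyperplane[of e 0]])
       (use e in \<open>auto simp: H_def H'_def inner_commute\<close>)
  then have "emeasure lborel (H \<inter> H') = 0"
    by (auto simp: negligible_iff_null_sets null_sets_def)
  then have "emeasure lborel (H \<union> H') = emeasure lborel H + emeasure lborel H'"
    using emeasure_Un_Int[of H lborel H'] by simp
  moreover have "H \<union> H' = B"
    by (auto simp: H_def H'_def)
  moreover have "H \<subseteq> B" "H' \<subseteq> B"
    by (auto simp: H_def H'_def)
  ultimately have "emeasure lborel B = emeasure lborel H + emeasure lborel H'"
    and fins: "emeasure lborel H < top" "emeasure lborel H' < top"
    using fin[of H] fin[of H'] by auto
  then have B2: "measure lborel B = 2 * measure lborel H"
    using eq by (simp add: measure_def enn2real_plus)
  have "emeasure lborel (ball (0::'a) 1) \<le> emeasure lborel ({0} \<union> B)"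
    by (intro emeasure_mono) (auto simp: B_def)
  also have "\<dots> \<le> emeasure lborel {0::'a} + emeasure lborel B"
    by (intro emeasure_subadditive) auto
  finally have "emeasure lborel (ball (0::'a) 1) \<le> emeasure lborel B"
    by simp
  then have "measure lborel (ball (0::'a) 1) \<le> measure lborel B"
    unfolding measure_def using fin[of B] by (intro enn2real_mono) auto
  then have pos: "measure lborel B > 0"
    using content_ball_pos[of 1 "0::'a"] by linarith
  have area: "sphere_area TYPE('a) = real DIM('a) * measure lborel B"
    by (simp add: sphere_area_def measure_def full D_def enn2real_mult)
  have "emeasure (uniform_halfsphere e) (halfsphere e)
      = ennreal (2 / sphere_area TYPE('a)) * (D * emeasure lborel H)"
  proof -
    have "halfsphere e \<inter> space spherical_lebesgue \<in> sets spherical_lebesgue"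
      by (rule sets.Int[OF halfsphere_sets sets.top])
    then have "emeasure (restrict_space spherical_lebesgue (halfsphere e)) (halfsphere e)
        = emeasure spherical_lebesgue (halfsphere e)"
      by (rule emeasure_restrict_space) simp
    then show ?thesis
      by (simp add: uniform_halfsphere_def half)
  qed
  also have "emeasure lborel H = ennreal (measure lborel H)"
    using fins by (intro emeasure_eq_ennreal_measure) auto
  also have "ennreal (2 / sphere_area TYPE('a)) * (D * ennreal (measure lborel H))
      = ennreal (2 / sphere_area TYPE('a) * (real DIM('a) * measure lborel H))"
    unfolding D_def area by (simp add: ennreal_mult[symmetric])
  also have "2 / sphere_area TYPE('a) * (real DIM('a) * measure lborel H) = 1"
    using pos B2 by (simp add: area field_simps)
  finally show ?thesis
    by (intro prob_spaceI)
       (auto simp: uniform_halfsphere_def space_restrict_space halfsphere_def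
          space_scale_measure Int_absorb2 Int_def cong: conj_cong)
qed

end

theory Submission
  imports Defs
begin

text \<open>Every point \<open>y\<close> of \<open>P\<^sub>n\<close> satisfies \<open>y \<bullet> e \<ge> min\<^sub>i (X\<^sub>i \<bullet> e)\<close>, because the coefficients of a positive
  combination of unit vectors that is itself a unit vector sum to at least 1. Hence a boundary
  point of the half sphere has distance at least \<open>min\<^sub>i (X\<^sub>i \<bullet> e)\<close> from \<open>P\<^sub>n\<close>. Since
  \<open>X\<^sub>i \<bullet> e < t\<close> has probability at most \<open>C t\<close>, some \<open>i \<le> n\<close> has \<open>X\<^sub>i \<bullet> e < n powr (- \<gamma>)\<close> with
  probability at most \<open>C n powr (1 - \<gamma>)\<close>, which is summable for \<open>\<gamma> > 2\<close>; the Borel-Cantelli lemma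
  applies. As \<open>M\<close> need not be complete, the event must also be shown measurable.\<close>

section \<open>Positive and spherical hulls of finite families\<close>

text \<open>Coefficients indexed by \<open>I\<close> instead of by points keep the index set fixed
  when the points vary or coincide. Since \<open>f\<close> may fail to be injective, one inclusion
  chooses one index for each point and sets the remaining coefficients to 0, while the other adds up
  the coefficients over each fibre of \<open>f\<close>.\<close>

lemma pos_hull_image:
  assumes "finite I"
  shows "pos_hull (f ` I) = {\<Sum>i\<in>I. c i *\<^sub>R f i | c. \<forall>i\<in>I. 0 \<le> c i}"
proof (intro equalityI subsetI)
  fix y assume "y \<in> pos_hull (f ` I)"
  then obtain F c where F: "finite F" "F \<subseteq> f ` I" "\<forall>x\<in>F. 0 \<le> c x"
    and y: "y = (\<Sum>x\<in>F. c x *\<^sub>R x)"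
    unfolding pos_hull_def by blast
  let ?g = "inv_into I f"
  define b where "b i = (if i \<in> ?g ` F then c (f i) else 0)" for i
  have sub: "?g ` F \<subseteq> I"
    using F(2) inv_into_into[of _ f I] by blast
  have fg: "f (?g x) = x" if "x \<in> F" for x
    using that F(2) f_inv_into_f[of x f I] by blast
  have "(\<Sum>i\<in>I. b i *\<^sub>R f i) = (\<Sum>i\<in>?g ` F. c (f i) *\<^sub>R f i)"
    using assms sub by (intro sum.mono_neutral_cong_right) (auto simp: b_def)
  also have "\<dots> = (\<Sum>x\<in>F. c x *\<^sub>R x)"
    using inj_on_inv_into[OF F(2)] by (subst sum.reindex) (auto simp: fg intro!: sum.cong)
  finally have "y = (\<Sum>i\<in>I. b i *\<^sub>R f i)"
    by (simp add: y)
  moreover have "\<forall>i\<in>I. 0 \<le> b i"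
    using F(3) by (auto simp: b_def fg)
  ultimately show "y \<in> {\<Sum>i\<in>I. c i *\<^sub>R f i | c. \<forall>i\<in>I. 0 \<le> c i}"
    by blast
next
  fix y assume "y \<in> {\<Sum>i\<in>I. c i *\<^sub>R f i | c. \<forall>i\<in>I. 0 \<le> c i}"
  then obtain c where c: "\<forall>i\<in>I. 0 \<le> c i" and y: "y = (\<Sum>i\<in>I. c i *\<^sub>R f i)"
    by blast
  define b where "b x = (\<Sum>i\<in>{i\<in>I. f i = x}. c i)" for x
  have "y = (\<Sum>x\<in>f ` I. \<Sum>i\<in>{i\<in>I. f i = x}. c i *\<^sub>R f i)"
    unfolding y by (rule sum.image_gen[OF assms])
  also have "\<dots> = (\<Sum>x\<in>f ` I. b x *\<^sub>R x)"
    by (auto simp: b_def scaleR_sum_left intro!: sum.cong)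
  finally have "y = (\<Sum>x\<in>f ` I. b x *\<^sub>R x)" .
  moreover have "\<forall>x\<in>f ` I. 0 \<le> b x"
    using c by (auto simp: b_def intro!: sum_nonneg)
  ultimately show "y \<in> pos_hull (f ` I)"
    unfolding pos_hull_def using assms by blast
qed

lemma spherical_hull_image_inner_ge:
  assumes "finite I" "f ` I \<subseteq> sphere 0 1" "0 \<le> t" "\<And>i. i \<in> I \<Longrightarrow> t \<le> f i \<bullet> e"
    and y: "y \<in> spherical_hull (f ` I)"
  shows "t \<le> y \<bullet> e"
proof -
  obtain c where c: "\<forall>i\<in>I. 0 \<le> c i" and y': "y = (\<Sum>i\<in>I. c i *\<^sub>R f i)" and "norm y = 1"
    using y by (auto simp: spherical_hull_def pos_hull_image[OF assms(1)])
  have "norm y \<le> (\<Sum>i\<in>I. norm (c i *\<^sub>R f i))"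
    unfolding y' by (rule norm_sum)
  also have "\<dots> = (\<Sum>i\<in>I. c i)"
    using c assms(2) by (intro sum.cong) auto
  finally have "1 \<le> (\<Sum>i\<in>I. c i)"
    using \<open>norm y = 1\<close> by simp
  then have "t \<le> (\<Sum>i\<in>I. c i) * t"
    using assms(3) mult_right_mono[of 1 _ t] by simp
  also have "\<dots> \<le> (\<Sum>i\<in>I. c i * (f i \<bullet> e))"
    using c assms(4) by (auto simp: sum_distrib_right intro!: sum_mono mult_left_mono)
  also have "\<dots> = y \<bullet> e"
    by (simp add: y' inner_sum_left)
  finally show ?thesis .
qed

text \<open>This is the case \<open>t = 0\<close> of the preceding bound.\<close>

lemma spherical_hull_image_subset_halfsphere:
  assumes "finite I" "f ` I \<subseteq> halfsphere e"
  shows "spherical_hull (f ` I) \<subseteq> halfsphere e"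
proof
  fix y assume y: "y \<in> spherical_hull (f ` I)"
  have "0 \<le> y \<bullet> e"
    by (rule spherical_hull_image_inner_ge[OF assms(1) _ _ _ y])
      (use assms(2) in \<open>auto simp: halfsphere_def\<close>)
  then show "y \<in> halfsphere e"
    using y by (auto simp: spherical_hull_def halfsphere_def)
qed

lemma spherical_hull_superset:
  assumes "A \<subseteq> sphere 0 1"
  shows "A \<subseteq> spherical_hull A"
proof
  fix x assume "x \<in> A"
  then have "x = (\<Sum>y\<in>{x}. 1 *\<^sub>R y)" "{x} \<subseteq> A"
    by auto
  then have "x \<in> pos_hull A"
    unfolding pos_hull_def by (intro CollectI exI[of _ "{x}"] exI[of _ "\<lambda>_. 1"]) auto
  then show "x \<in> spherical_hull A"
    using \<open>x \<in> A\<close> assms by (auto simp: spherical_hull_def)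
qed

text \<open>Nonnegative real coefficients are limits of fractions \<open>k i / m\<close>, and
  \<open>sgn\<close> removes the common factor \<open>1 / m\<close>, so natural coefficients suffice
  up to closure. The extensional functions from the finite set \<open>I\<close> to the naturals form
  a countable set, which is what measurability needs later.\<close>

lemma spherical_hull_image_subset_closure:
  fixes f :: "'i \<Rightarrow> 'a::euclidean_space"
  assumes "finite I"
  shows "spherical_hull (f ` I) \<subseteq>
    closure {sgn (\<Sum>i\<in>I. real (k i) *\<^sub>R f i) | k.
      k \<in> (\<Pi>\<^sub>E i\<in>I. UNIV :: nat set) \<and> (\<Sum>i\<in>I. real (k i) *\<^sub>R f i) \<noteq> 0}"
    (is "_ \<subseteq> closure ?Q")
proof
  fix y assume "y \<in> spherical_hull (f ` I)"
  then obtain c where c: "\<forall>i\<in>I. 0 \<le> c i" and y: "y = (\<Sum>i\<in>I. c i *\<^sub>R f i)" and ny: "norm y = 1"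
    by (auto simp: spherical_hull_def pos_hull_image[OF assms(1)])
  \<comment> \<open>Rounding down costs less than 1 before the division by \<open>m\<close>, so
    \<open>k m i / m\<close> tends to \<open>c i\<close>. The restriction makes \<open>k m\<close>
    extensional.\<close>
  define k where "k m = restrict (\<lambda>i. nat \<lfloor>real m * c i\<rfloor>) I" for m :: nat
  define z where "z m = (\<Sum>i\<in>I. real (k m i) *\<^sub>R f i)" for m :: nat
  have lim: "(\<lambda>m. real (k m i) / real m) \<longlonglongrightarrow> c i" if "i \<in> I" for i
  proof (rule tendsto_sandwich)
    have ci: "0 \<le> c i"
      using c that by blast
    have ki: "real (k m i) = of_int \<lfloor>real m * c i\<rfloor>" for m
      using that ci by (simp add: k_def)
    show "\<forall>\<^sub>F m in sequentially. c i - 1 / real m \<le> real (k m i) / real m"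
      using eventually_gt_at_top[of 0]
    proof eventually_elim
      case (elim m)
      have "c i - 1 / real m = (real m * c i - 1) / real m"
        using elim by (simp add: field_simps)
      also have "\<dots> \<le> real (k m i) / real m"
        unfolding ki by (intro divide_right_mono) linarith+
      finally show ?case .
    qed
    show "\<forall>\<^sub>F m in sequentially. real (k m i) / real m \<le> c i"
      using eventually_gt_at_top[of 0]
      by eventually_elim (simp add: ki field_simps)
    show "(\<lambda>m. c i - 1 / real m) \<longlonglongrightarrow> c i"
      using tendsto_diff[OF tendsto_const lim_const_over_n[of 1]] by simp
  qed auto
  have "(\<lambda>m. \<Sum>i\<in>I. (real (k m i) / real m) *\<^sub>R f i) \<longlonglongrightarrow> y"
    unfolding y by (intro tendsto_sum tendsto_scaleR lim tendsto_const)
  then have zlim: "(\<lambda>m. (1 / real m) *\<^sub>R z m) \<longlonglongrightarrow> y"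
    by (simp add: z_def scaleR_sum_right)
  \<comment> \<open>Away from 0 the function \<open>sgn\<close> is continuous; moreover
    \<open>z m\<close> is nonzero for all large \<open>m\<close>, as membership in the set on the
    right requires.\<close>
  have "y \<noteq> 0"
    using ny by auto
  then have "(\<lambda>m. sgn ((1 / real m) *\<^sub>R z m)) \<longlonglongrightarrow> sgn y"
    by (intro tendsto_sgn zlim)
  moreover have "sgn y = y"
    using ny by (simp add: sgn_div_norm)
  moreover have "\<forall>\<^sub>F m in sequentially. sgn ((1 / real m) *\<^sub>R z m) = sgn (z m)"
    using eventually_gt_at_top[of 0]
    by eventually_elim (simp add: sgn_scaleR)
  ultimately have slim: "(\<lambda>m. sgn (z m)) \<longlonglongrightarrow> y"
    using Lim_transform_eventually by fastforce
  have "\<forall>\<^sub>F m in sequentially. (1 / real m) *\<^sub>R z m \<noteq> 0"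
    by (rule tendsto_imp_eventually_ne[OF zlim \<open>y \<noteq> 0\<close>])
  then have "\<forall>\<^sub>F m in sequentially. sgn (z m) \<in> ?Q"
  proof eventually_elim
    case (elim m)
    then show ?case
      by (intro CollectI exI[of _ "k m"]) (auto simp: z_def k_def)
  qed
  then have "\<forall>\<^sub>F m in sequentially. sgn (z m) \<in> closure ?Q"
    by (rule eventually_mono) (rule subsetD[OF closure_subset])
  then show "y \<in> closure ?Q"
    by (rule Lim_in_closed_set[OF closed_closure _ _ slim]) simp
qed

section \<open>Spherical distance and Hausdorff distance to the half sphere\<close>

lemma inner_sphere_bounds:
  assumes "x \<in> sphere 0 1" "y \<in> sphere (0::'a::euclidean_space) 1"
  shows "-1 \<le> x \<bullet> y" "x \<bullet> y \<le> 1"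
  using Cauchy_Schwarz_ineq2[of x y] assms by (auto simp: abs_le_iff)

lemma spherical_dist_bounds:
  assumes "x \<in> sphere 0 1" "y \<in> sphere (0::'a::euclidean_space) 1"
  shows "0 \<le> spherical_dist x y" "spherical_dist x y \<le> pi"
  using inner_sphere_bounds[OF assms] by (auto simp: spherical_dist_def arccos_lbound arccos_ubound)

text \<open>Infima and suprema of reals can be compared with the members only when the set is
  bounded. These bounds and the next lemma supply that for all later estimates.\<close>

lemma INF_spherical_dist_bounds:
  assumes "K \<noteq> {}" "K \<subseteq> sphere 0 1" "x \<in> sphere (0::'a::euclidean_space) 1"
  shows "bdd_below (spherical_dist x ` K)"
    "0 \<le> (INF y\<in>K. spherical_dist x y)" "(INF y\<in>K. spherical_dist x y) \<le> pi"
proof -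
  show bdd: "bdd_below (spherical_dist x ` K)"
    using spherical_dist_bounds[OF assms(3)] assms(2) by (intro bdd_belowI2[of _ 0]) auto
  show "0 \<le> (INF y\<in>K. spherical_dist x y)"
    using spherical_dist_bounds[OF assms(3)] assms by (intro cINF_greatest) auto
  obtain y where "y \<in> K"
    using assms(1) by blast
  then have "(INF y\<in>K. spherical_dist x y) \<le> spherical_dist x y"
    by (rule cINF_lower[OF bdd])
  then show "(INF y\<in>K. spherical_dist x y) \<le> pi"
    using spherical_dist_bounds(2)[OF assms(3), of y] \<open>y \<in> K\<close> assms(2) by force
qed

lemma bdd_above_INF_spherical_dist:
  assumes "K \<noteq> {}" "K \<subseteq> sphere 0 1" "M \<subseteq> sphere (0::'a::euclidean_space) 1"
  shows "bdd_above ((\<lambda>x. INF y\<in>K. spherical_dist x y) ` M)"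
  using INF_spherical_dist_bounds(3)[OF assms(1,2)] assms(3) by (intro bdd_aboveI2[of _ _ pi]) auto

text \<open>Each point of \<open>K\<close> has distance 0 from \<open>M\<close>, attained at the
  point itself, so one of the two one-sided distances is 0. The other is nonnegative and therefore
  is the maximum.\<close>

lemma spherical_hausdorff_subset:
  assumes "K \<noteq> {}" "K \<subseteq> M" "M \<subseteq> sphere (0::'a::euclidean_space) 1"
  shows "spherical_hausdorff K M = (SUP x\<in>M. INF y\<in>K. spherical_dist x y)"
proof -
  have KS: "K \<subseteq> sphere 0 1" and M: "M \<noteq> {}"
    using assms by auto
  have "(INF y\<in>M. spherical_dist x y) = 0" if x: "x \<in> K" for x
  proof (rule antisym)
    have xs: "x \<in> sphere 0 1"
      using x KS by blast
    have "(INF y\<in>M. spherical_dist x y) \<le> spherical_dist x x"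
      by (rule cINF_lower[OF INF_spherical_dist_bounds(1)[OF M assms(3) xs]]) (use x assms in blast)
    also have "\<dots> = 0"
      using xs by (simp add: spherical_dist_def dot_square_norm)
    finally show "(INF y\<in>M. spherical_dist x y) \<le> 0" .
    show "0 \<le> (INF y\<in>M. spherical_dist x y)"
      by (rule INF_spherical_dist_bounds(2)[OF M assms(3) xs])
  qed
  then have first: "(SUP x\<in>K. INF y\<in>M. spherical_dist x y) = 0"
    using assms(1) by (simp cong: SUP_cong_simp)
  obtain x where x: "x \<in> M"
    using M by blast
  have "0 \<le> (INF y\<in>K. spherical_dist x y)"
    using INF_spherical_dist_bounds(2)[OF assms(1) KS] x assms(3) by blast
  also have "\<dots> \<le> (SUP x\<in>M. INF y\<in>K. spherical_dist x y)"
    by (rule cSUP_upper[OF x bdd_above_INF_spherical_dist[OF assms(1) KS assms(3)]])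
  finally show ?thesis
    by (simp add: spherical_hausdorff_def first)
qed

text \<open>Both quantifiers on the right range over countable sets when \<open>D\<close> is countable; this is what
  makes the Hausdorff distance of a random hull measurable.\<close>

lemma spherical_hausdorff_hull_ge_iff:
  fixes f :: "'i \<Rightarrow> 'a::euclidean_space"
  assumes I: "finite I" "I \<noteq> {}" and f: "f ` I \<subseteq> halfsphere e"
    and D: "D \<subseteq> halfsphere e" "halfsphere e \<subseteq> closure D"
  shows "c \<le> spherical_hausdorff (spherical_hull (f ` I)) (halfsphere e) \<longleftrightarrow>
    (\<forall>m::nat. \<exists>u\<in>D. \<forall>k\<in>(\<Pi>\<^sub>E i\<in>I. UNIV :: nat set). (\<Sum>i\<in>I. real (k i) *\<^sub>R f i) \<noteq> 0 \<longrightarrow>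
      c - 1 / real (Suc m) \<le> spherical_dist u (sgn (\<Sum>i\<in>I. real (k i) *\<^sub>R f i)))"
    (is "_ \<longleftrightarrow> (\<forall>m. \<exists>u\<in>D. ?R m u)")
proof -
  let ?P = "spherical_hull (f ` I)"
  let ?S = "\<lambda>k. \<Sum>i\<in>I. real (k i) *\<^sub>R f i"
  let ?Q = "{sgn (?S k) | k. k \<in> (\<Pi>\<^sub>E i\<in>I. UNIV :: nat set) \<and> ?S k \<noteq> 0}"
  have H: "halfsphere e \<subseteq> sphere 0 1"
    by (auto simp: halfsphere_def)
  have PH: "?P \<subseteq> halfsphere e"
    by (rule spherical_hull_image_subset_halfsphere[OF I(1) f])
  then have PS: "?P \<subseteq> sphere 0 1"
    using H by blast
  have P: "?P \<noteq> {}"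
    using spherical_hull_superset[of "f ` I"] f H I(2) by blast
  have HN: "halfsphere e \<noteq> {}"
    using P PH by blast
  \<comment> \<open>Division by the norm keeps the coefficients nonnegative, so \<open>?Q\<close>
    lies in the hull. Combined with the density of \<open>?Q\<close>, this turns
    \<open>?R m u\<close> into a lower bound for the distance from \<open>u\<close> to every point
    of the hull.\<close>
  have "sgn (?S k) \<in> ?P" if "?S k \<noteq> 0" for k
  proof -
    have "sgn (?S k) = (\<Sum>i\<in>I. (real (k i) / norm (?S k)) *\<^sub>R f i)"
      by (simp add: sgn_div_norm scaleR_sum_right divide_inverse mult.commute)
    moreover have "\<forall>i\<in>I. 0 \<le> real (k i) / norm (?S k)"
      by simp
    ultimately have "sgn (?S k) \<in> pos_hull (f ` I)"
      unfolding pos_hull_image[OF I(1)] by (intro CollectI exI conjI)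
    then show ?thesis
      using that by (simp add: spherical_hull_def norm_sgn)
  qed
  then have QP: "?Q \<subseteq> ?P"
    by blast
  \<comment> \<open>The closure must stay on the sphere, so that inner products remain in the
    interval [-1, 1] where \<open>arccos\<close> is known to be continuous.\<close>
  have QS: "closure ?Q \<subseteq> sphere 0 1"
    using QP PS by (intro closure_minimal) auto
  have R: "?R m u \<longleftrightarrow> (\<forall>y\<in>?P. c - 1 / real (Suc m) \<le> spherical_dist u y)"
    if u: "u \<in> sphere 0 1" for m u
  proof
    assume "?R m u"
    then have *: "c - 1 / real (Suc m) \<le> spherical_dist u y" if "y \<in> ?Q" for y
      using that by blast
    show "\<forall>y\<in>?P. c - 1 / real (Suc m) \<le> spherical_dist u y"
    proof
      fix y assume "y \<in> ?P"
      then have "y \<in> closure ?Q"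
        using spherical_hull_image_subset_closure[OF I(1), of f] by blast
      then show "c - 1 / real (Suc m) \<le> spherical_dist u y"
      proof (rule continuous_ge_on_closure[rotated])
        show "continuous_on (closure ?Q) (spherical_dist u)"
          unfolding spherical_dist_def[abs_def] using inner_sphere_bounds[OF u] QS
          by (intro continuous_intros) auto
      qed (use * in blast)
    qed
  next
    assume "\<forall>y\<in>?P. c - 1 / real (Suc m) \<le> spherical_dist u y"
    then show "?R m u"
      using QP by blast
  qed
  have "c \<le> spherical_hausdorff ?P (halfsphere e) \<longleftrightarrow>
      c \<le> (SUP u\<in>halfsphere e. INF y\<in>?P. spherical_dist u y)" (is "_ \<longleftrightarrow> c \<le> ?s")
    by (simp add: spherical_hausdorff_subset[OF P PH H])
  also have "\<dots> \<longleftrightarrow> (\<forall>m. \<exists>u\<in>D. ?R m u)"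
  proof (intro iffI allI)
    fix m :: nat assume "c \<le> ?s"
    \<comment> \<open>Half of \<epsilon> is spent on a point \<open>u\<close> that almost attains
      the supremum, the other half on moving \<open>u\<close> to a nearby \<open>v\<close> in
      \<open>D\<close>.\<close>
    define \<epsilon> where "\<epsilon> = 1 / real (Suc m)"
    have "0 < \<epsilon>"
      by (simp add: \<epsilon>_def)
    then have "c - \<epsilon> / 2 < ?s"
      using \<open>c \<le> ?s\<close> by linarith
    then obtain u where u: "u \<in> halfsphere e" "c - \<epsilon> / 2 < (INF y\<in>?P. spherical_dist u y)"
      using less_cSUP_iff[OF HN bdd_above_INF_spherical_dist[OF P PS H]] by blast
    \<comment> \<open>\<open>arccos\<close> is not Lipschitz at the end points of its interval;
      uniform continuity still gives one \<delta> that serves all \<open>y\<close> in the hull at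
      once.\<close>
    have "uniformly_continuous_on {-1..1} arccos"
      by (intro compact_uniformly_continuous continuous_on_arccos') auto
    then obtain \<delta> where "\<delta> > 0" and \<delta>: "\<And>x x'. x \<in> {-1..1} \<Longrightarrow> x' \<in> {-1..1} \<Longrightarrow> dist x' x < \<delta>
        \<Longrightarrow> dist (arccos x') (arccos x) < \<epsilon> / 2"
      using \<open>0 < \<epsilon>\<close> unfolding uniformly_continuous_on_def by (metis half_gt_zero)
    obtain v where v: "v \<in> D" "dist v u < \<delta>"
      using u(1) D(2) \<open>\<delta> > 0\<close> closure_approachable by blast
    have uS: "u \<in> sphere 0 1" and vS: "v \<in> sphere 0 1"
      using u(1) v(1) D(1) H by auto
    have "c - \<epsilon> \<le> spherical_dist v y" if y: "y \<in> ?P" for y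
    proof -
      have yS: "y \<in> sphere 0 1"
        using y PS by blast
      have "dist (v \<bullet> y) (u \<bullet> y) = \<bar>(v - u) \<bullet> y\<bar>"
        by (simp add: dist_real_def inner_diff_left)
      also have "\<dots> \<le> dist v u"
        using Cauchy_Schwarz_ineq2[of "v - u" y] yS by (simp add: dist_norm)
      finally have "dist (arccos (v \<bullet> y)) (arccos (u \<bullet> y)) < \<epsilon> / 2"
        using v(2) inner_sphere_bounds[OF uS yS] inner_sphere_bounds[OF vS yS] by (intro \<delta>) auto
      moreover have "(INF y\<in>?P. spherical_dist u y) \<le> spherical_dist u y"
        by (rule cINF_lower[OF INF_spherical_dist_bounds(1)[OF P PS uS] y])
      ultimately show ?thesis
        using u(2) unfolding spherical_dist_def dist_real_def by linarith
    qed
    then have "?R m v"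
      unfolding R[OF vS] \<epsilon>_def by blast
    then show "\<exists>u\<in>D. ?R m u"
      using v(1) by blast
  next
    assume r: "\<forall>m. \<exists>u\<in>D. ?R m u"
    show "c \<le> ?s"
    \<comment> \<open>The slack \<open>1 / Suc m\<close> is arbitrarily small, so it does not affect
      the comparison with \<open>c\<close>.\<close>
    proof (rule field_le_epsilon)
      fix \<epsilon> :: real assume "0 < \<epsilon>"
      then obtain m where m: "1 / real (Suc m) < \<epsilon>"
        using nat_approx_posE by blast
      obtain u where u: "u \<in> D" "?R m u"
        using r by blast
      then have uH: "u \<in> halfsphere e" and uS: "u \<in> sphere 0 1"
        using D(1) H by auto
      have "c - 1 / real (Suc m) \<le> (INF y\<in>?P. spherical_dist u y)"
        using u(2) P unfolding R[OF uS] by (intro cINF_greatest) auto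
      also have "\<dots> \<le> ?s"
        by (rule cSUP_upper[OF uH bdd_above_INF_spherical_dist[OF P PS H]])
      finally show "c \<le> ?s + \<epsilon>"
        using m by linarith
    qed
  qed
  finally show ?thesis .
qed

text \<open>Only points on the boundary of the half sphere are needed: the sine of the distance from
  a unit vector \<open>u\<close> orthogonal to \<open>e\<close> to a point \<open>y\<close> is at least \<open>y \<bullet> e\<close> by Bessel's inequality.\<close>

lemma spherical_hausdorff_hull_ge:
  fixes f :: "'i \<Rightarrow> 'a::euclidean_space"
  assumes dim: "2 \<le> DIM('a)" and e: "norm e = 1"
    and I: "finite I" "I \<noteq> {}" and f: "f ` I \<subseteq> halfsphere e"
    and t: "0 \<le> t" "\<And>i. i \<in> I \<Longrightarrow> t \<le> f i \<bullet> e"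
  shows "t \<le> spherical_hausdorff (spherical_hull (f ` I)) (halfsphere e)"
proof -
  let ?P = "spherical_hull (f ` I)"
  have H: "halfsphere e \<subseteq> sphere 0 1"
    by (auto simp: halfsphere_def)
  have PH: "?P \<subseteq> halfsphere e"
    by (rule spherical_hull_image_subset_halfsphere[OF I(1) f])
  then have PS: "?P \<subseteq> sphere 0 1"
    using H by blast
  have P: "?P \<noteq> {}"
    using spherical_hull_superset[of "f ` I"] f H I(2) by blast
  obtain u' where u': "u' \<noteq> 0" "orthogonal e u'"
    using orthogonal_to_vector_exists[OF dim] by blast
  define u where "u = sgn u'"
  have u: "norm u = 1" "e \<bullet> u = 0"
    using u' by (auto simp: u_def norm_sgn sgn_div_norm orthogonal_def)
  have uS: "u \<in> sphere 0 1" and uH: "u \<in> halfsphere e"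
    using u by (auto simp: halfsphere_def inner_commute)
  have "t \<le> spherical_dist u y" if y: "y \<in> ?P" for y
  proof -
    have yS: "y \<in> sphere 0 1"
      using y PS by blast
    have ty: "t \<le> y \<bullet> e"
      by (rule spherical_hull_image_inner_ge[OF I(1) _ t y]) (use f H in auto)
    have sq: "u \<bullet> u = 1" "e \<bullet> e = 1" "y \<bullet> y = 1"
      using u(1) e yS by (simp_all add: dot_square_norm)
    \<comment> \<open>This is the squared norm of the component of \<open>y\<close> orthogonal to
      both \<open>u\<close> and \<open>e\<close>.\<close>
    have "0 \<le> (y - (u \<bullet> y) *\<^sub>R u - (y \<bullet> e) *\<^sub>R e) \<bullet> (y - (u \<bullet> y) *\<^sub>R u - (y \<bullet> e) *\<^sub>R e)"
      by simp
    also have "\<dots> = 1 - (u \<bullet> y)\<^sup>2 - (y \<bullet> e)\<^sup>2"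
      using u(2) sq by (simp add: inner_diff_left inner_diff_right inner_commute power2_eq_square)
    finally have "t\<^sup>2 \<le> 1 - (u \<bullet> y)\<^sup>2"
      using power_mono[OF ty t(1), of 2] by linarith
    then have "t \<le> sqrt (1 - (u \<bullet> y)\<^sup>2)"
      by (rule real_le_rsqrt)
    also have "\<dots> = sin (spherical_dist u y)"
      using inner_sphere_bounds[OF uS yS] by (simp add: spherical_dist_def sin_arccos)
    also have "\<dots> \<le> spherical_dist u y"
      by (rule sin_x_le_x[OF spherical_dist_bounds(1)[OF uS yS]])
    finally show ?thesis .
  qed
  then have "t \<le> (INF y\<in>?P. spherical_dist u y)"
    using P by (intro cINF_greatest) auto
  also have "\<dots> \<le> (SUP u\<in>halfsphere e. INF y\<in>?P. spherical_dist u y)"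
    by (rule cSUP_upper[OF uH bdd_above_INF_spherical_dist[OF P PS H]])
  finally show ?thesis
    by (simp add: spherical_hausdorff_subset[OF P PH H])
qed

section \<open>Volume of a thin slab\<close>

text \<open>About \<open>1 / t\<close> disjoint translates of the slab fit into a ball of radius 2.\<close>

lemma measure_slab_le:
  fixes e :: "'a::euclidean_space"
  assumes e: "norm e = 1" and t: "0 < t" "t \<le> 1"
  shows "measure lborel {x \<in> cball 0 1. 0 \<le> x \<bullet> e \<and> x \<bullet> e < t} \<le>
    2 * measure lborel (cball (0::'a) 2) * t"
proof -
  \<comment> \<open>The inequality \<open>N * t <= 1\<close> keeps the translates inside the ball of
    radius 2. Conversely \<open>1 / t < N + 1 <= 2 * N\<close>, which is the source of the factor 2
    in the bound.\<close>
  define N where "N = nat \<lfloor>1 / t\<rfloor>"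
  \<comment> \<open>\<open>B 0\<close> is the slab itself and \<open>B j\<close> its translate by
    \<open>j * t\<close> along \<open>e\<close>. The half-open intervals for
    \<open>x \<bullet> e\<close> make these sets disjoint.\<close>
  define B where "B j = {x \<in> cball ((real j * t) *\<^sub>R e) 1.
      real j * t \<le> x \<bullet> e \<and> x \<bullet> e < (real j + 1) * t}" for j :: nat
  have ee: "e \<bullet> e = 1"
    using e by (simp add: dot_square_norm)
  have "1 \<le> 1 / t"
    using t by simp
  then have N: "1 \<le> N" "real N \<le> 1 / t" "1 / t < real N + 1"
    unfolding N_def by linarith+
  then have Nt: "real N * t \<le> 1" "1 \<le> 2 * real N * t"
  proof -
    show "real N * t \<le> 1"
      using N(2) t by (simp add: field_simps)
    have "1 / t \<le> 2 * real N"
      using N by linarith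
    then show "1 \<le> 2 * real N * t"
      using t by (simp add: field_simps)
  qed
  have Bm: "B j \<in> sets lborel" for j
    by (simp add: B_def)
  have Bsub: "B j \<subseteq> cball 0 2" if "j < N" for j
  proof
    fix x assume "x \<in> B j"
    then have "norm (x - (real j * t) *\<^sub>R e) \<le> 1"
      by (simp add: B_def dist_norm norm_minus_commute)
    moreover have "norm ((real j * t) *\<^sub>R e) \<le> 1"
    proof -
      have "real j * t \<le> real N * t"
        using that t by (intro mult_right_mono) auto
      then have "real j * t \<le> 1"
        using Nt(1) by linarith
      then show ?thesis
        using t e by simp
    qed
    ultimately show "x \<in> cball 0 2"
      using norm_triangle_sub[of x "(real j * t) *\<^sub>R e"] by simp
  qed
  have fin: "emeasure lborel (B j) < \<infinity>" for j
    by (rule emeasure_bounded_finite, rule bounded_subset[OF bounded_cball])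
      (auto simp: B_def)
  have disj: "disjoint_family_on B {..<N}"
  proof -
    have False if "i < j" "x \<in> B i" "x \<in> B j" for i j x
    proof -
      have "(real i + 1) * t \<le> real j * t"
        using that(1) t by (intro mult_right_mono) auto
      then show False
        using that(2,3) by (simp add: B_def)
    qed
    then show ?thesis
      unfolding disjoint_family_on_def by (metis disjoint_iff linorder_neqE_nat)
  qed
  have "B j = (+) ((real j * t) *\<^sub>R e) ` B 0" for j
  proof (intro equalityI subsetI)
    fix x assume "x \<in> B j"
    then have "x - (real j * t) *\<^sub>R e \<in> B 0"
      by (auto simp: B_def ee dist_norm norm_minus_commute algebra_simps)
    then show "x \<in> (+) ((real j * t) *\<^sub>R e) ` B 0"
      by (auto intro!: image_eqI[of _ _ "x - (real j * t) *\<^sub>R e"])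
  qed (auto simp: B_def ee dist_norm algebra_simps)
  \<comment> \<open>Translation invariance is taken from Lebesgue measure and carried back to
    \<open>lborel\<close>, since every \<open>B j\<close> is Borel.\<close>
  then have "measure lebesgue (B j) = measure lebesgue (B 0)" for j
    by (metis measure_translation)
  then have eq: "measure lborel (B j) = measure lborel (B 0)" for j
    using Bm by simp
  have "real N * measure lborel (B 0) = (\<Sum>j<N. measure lborel (B 0))"
    by simp
  also have "\<dots> = (\<Sum>j<N. measure lborel (B j))"
    by (intro sum.cong refl eq[symmetric])
  also have "\<dots> = measure lborel (\<Union>j<N. B j)"
    using fin Bm disj by (subst measure_finite_Union) (auto simp: less_top)
  also have "\<dots> \<le> measure lborel (cball (0::'a) 2)"
    using Bsub Bm emeasure_bounded_finite[OF bounded_cball, of 0 2]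
    by (intro measure_mono_fmeasurable) (auto simp: fmeasurable_def)
  finally have V: "real N * measure lborel (B 0) \<le> measure lborel (cball (0::'a) 2)" .
  have "measure lborel (B 0) \<le> 2 * real N * t * measure lborel (B 0)"
    using mult_right_mono[OF Nt(2), of "measure lborel (B 0)"] by simp
  also have "\<dots> = 2 * t * (real N * measure lborel (B 0))"
    by simp
  also have "\<dots> \<le> 2 * t * measure lborel (cball (0::'a) 2)"
    using V t by (intro mult_left_mono) auto
  finally show ?thesis
    by (simp add: B_def mult_ac)
qed

section \<open>Measurability and the uniform measure of a thin strip\<close>

text \<open>Continuity settles the interval [-1, 1]. Outside it the description defining
  \<open>arccos\<close> has no witness, so the value is one fixed default and the function is
  constant there.\<close>

lemma borel_measurable_arccos [measurable]: "arccos \<in> borel_measurable borel"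
proof -
  have junk: "arccos x = (THE y. False)" if "x \<notin> {-1..1}" for x
  proof -
    have "(\<lambda>y. 0 \<le> y \<and> y \<le> pi \<and> cos y = x) = (\<lambda>y. False)"
      using that by auto
    then show ?thesis
      by (simp only: arccos_def)
  qed
  have "(\<lambda>x. if x \<in> {-1..1} then arccos x else (THE y. False)) \<in> borel_measurable borel"
    by (intro borel_measurable_continuous_on_if continuous_on_arccos' continuous_on_const) auto
  also have "(\<lambda>x. if x \<in> {-1..1} then arccos x else (THE y. False)) = arccos"
    using junk by auto
  finally show ?thesis .
qed

lemma sets_uniform_halfsphere:
  "sets (uniform_halfsphere e) = sets (restrict_space borel (halfsphere e))"
proof -
  have "sphere 0 1 \<inter> halfsphere e = halfsphere e"
    by (auto simp: halfsphere_def)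
  then show ?thesis
    by (simp add: uniform_halfsphere_def sets_restrict_restrict_space
        sets_restrict_space_cong[OF sets_spherical_lebesgue])
qed

lemma measurable_uniform_halfsphere_iff:
  "f \<in> M \<rightarrow>\<^sub>M uniform_halfsphere e \<longleftrightarrow> f \<in> borel_measurable M \<and> f \<in> space M \<rightarrow> halfsphere e"
  by (simp add: measurable_cong_sets[OF refl sets_uniform_halfsphere] measurable_restrict_space2_iff)

text \<open>The spherical measure of the strip is the dimension times the volume of the cone over
  it. Scaling by \<open>r <= 1\<close> does not increase the nonnegative number
  \<open>u \<bullet> e\<close>, so this cone lies in the slab of width \<open>t\<close>.\<close>

lemma uniform_halfsphere_strip_bound:
  fixes e :: "'a::euclidean_space"
  assumes e: "norm e = 1"
  obtains C where "\<And>t. 0 < t \<Longrightarrow> t \<le> 1 \<Longrightarrow>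
    measure (uniform_halfsphere e) {u \<in> halfsphere e. u \<bullet> e < t} \<le> C * t"
proof
  fix t :: real assume t: "0 < t" "t \<le> 1"
  define a where "a = 2 / sphere_area TYPE('a)"
  define A where "A = {u \<in> halfsphere e. u \<bullet> e < t}"
  define S where "S = {x \<in> cball 0 1. 0 \<le> x \<bullet> e \<and> x \<bullet> e < t}"
  have a: "0 \<le> a"
    by (simp add: a_def sphere_area_def)
  have "A = sphere 0 1 \<inter> {u. 0 \<le> u \<bullet> e \<and> u \<bullet> e < t}"
    by (auto simp: A_def halfsphere_def)
  then have Am: "A \<in> sets spherical_lebesgue"
    by (auto simp: sets_restrict_space intro!: imageI)
  have Sm: "S \<in> sets lborel"
    by (simp add: S_def)
  have Sfin: "emeasure lborel S < \<infinity>"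
    by (rule emeasure_bounded_finite, rule bounded_subset[OF bounded_cball[of 0 1]])
      (auto simp: S_def)
  have AH: "A \<subseteq> halfsphere e"
    by (auto simp: A_def)
  have "x \<in> S" if "x = r *\<^sub>R u" "0 < r" "r \<le> 1" "u \<in> A" for x r u
  proof -
    have "norm u = 1" "0 \<le> u \<bullet> e" "u \<bullet> e < t"
      using that(4) by (auto simp: A_def halfsphere_def)
    moreover have "r * (u \<bullet> e) \<le> 1 * (u \<bullet> e)"
      using calculation that by (intro mult_right_mono) auto
    ultimately show ?thesis
      using that by (auto simp: S_def)
  qed
  then have sub: "{r *\<^sub>R u | r u. 0 < r \<and> r \<le> 1 \<and> u \<in> A} \<subseteq> S"
    by blast
  have "emeasure (restrict_space spherical_lebesgue (halfsphere e)) A =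
      emeasure spherical_lebesgue A"
    by (rule emeasure_restrict_space[OF sets.Int[OF halfsphere_sets sets.top] AH])
  then have "emeasure (uniform_halfsphere e) A = ennreal a * emeasure spherical_lebesgue A"
    by (simp add: uniform_halfsphere_def a_def)
  also have "\<dots> \<le> ennreal a * (ennreal (real DIM('a)) * emeasure lborel S)"
    unfolding emeasure_spherical_lebesgue[OF Am]
    using sub Sm by (intro mult_left_mono emeasure_mono) auto
  also have "emeasure lborel S = ennreal (measure lborel S)"
    using Sfin by (intro emeasure_eq_ennreal_measure) auto
  also have "ennreal a * (ennreal (real DIM('a)) * ennreal (measure lborel S)) =
      ennreal (a * (real DIM('a) * measure lborel S))"
    using a by (simp add: ennreal_mult)
  finally have "measure (uniform_halfsphere e) A \<le> a * (real DIM('a) * measure lborel S)"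
    unfolding measure_def using a by (intro enn2real_leI) (auto simp: measure_def)
  also have "\<dots> \<le> a * (real DIM('a) * (2 * measure lborel (cball (0::'a) 2) * t))"
    using measure_slab_le[OF e t] a unfolding S_def by (intro mult_left_mono) auto
  finally show "measure (uniform_halfsphere e) {u \<in> halfsphere e. u \<bullet> e < t} \<le>
      (2 / sphere_area TYPE('a) * (real DIM('a) * (2 * measure lborel (cball (0::'a) 2)))) * t"
    by (simp add: A_def a_def mult_ac)
qed

section \<open>Measurability of the event and the Borel-Cantelli argument\<close>

theorem theorem8p5:
  fixes d :: nat and e :: "real ^ 'n" and M :: "'w measure"
    and X :: "nat \<Rightarrow> 'w \<Rightarrow> real ^ 'n" and \<gamma> :: real
  assumes "d \<ge> 2" and "CARD('n) = d + 1"
    and "e \<in> sphere 0 1"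
    and "prob_space M"
    and "prob_space.indep_vars M (\<lambda>_. uniform_halfsphere e) X {1..}"
    and "\<And>i. i \<ge> 1 \<Longrightarrow> distr M (uniform_halfsphere e) (X i) = uniform_halfsphere e"
    and "\<gamma> > 2"
  shows "measure M {\<omega> \<in> space M. \<forall>\<^sub>F n in sequentially.
           spherical_hausdorff (spherical_hull ((\<lambda>i. X i \<omega>) ` {1..n})) (halfsphere e)
             \<ge> real n powr (- \<gamma>)} = 1"
proof -
  interpret prob_space M by fact
  have e: "norm e = 1"
    using assms(3) by simp
  have dim: "2 \<le> DIM(real ^ 'n)"
    using assms(1,2) by simp
  have Xu: "X i \<in> M \<rightarrow>\<^sub>M uniform_halfsphere e" if "1 \<le> i" for i
    using assms(5) that unfolding indep_vars_def by auto
  have Xm: "X i \<in> borel_measurable M" if "1 \<le> i" for i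
    using Xu[OF that] by (simp add: measurable_uniform_halfsphere_iff)
  have XH: "X i \<omega> \<in> halfsphere e" if "1 \<le> i" "\<omega> \<in> space M" for i \<omega>
    using Xu[OF that(1)] that(2) by (auto simp: measurable_uniform_halfsphere_iff)
  let ?P = "\<lambda>\<omega> n. spherical_hausdorff (spherical_hull ((\<lambda>i. X i \<omega>) ` {1..n})) (halfsphere e)
             \<ge> real n powr (- \<gamma>)"
  let ?E = "{\<omega> \<in> space M. \<forall>\<^sub>F n in sequentially. ?P \<omega> n}"

  obtain D where D: "countable D" "D \<subseteq> halfsphere e" "halfsphere e \<subseteq> closure D"
    using separable by blast
  \<comment> \<open>\<open>Q n\<close> expresses the \<open>n\<close>-th inequality through
    quantifiers over countable sets only: the naturals, \<open>D\<close>, and the extensional maps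
    \<open>k\<close>.\<close>
  define Q where "Q n \<omega> \<longleftrightarrow> (\<forall>m::nat. \<exists>u\<in>D. \<forall>k\<in>(\<Pi>\<^sub>E i\<in>{1..n}. UNIV :: nat set).
      (\<Sum>i\<in>{1..n}. real (k i) *\<^sub>R X i \<omega>) \<noteq> 0 \<longrightarrow> real n powr (- \<gamma>) - 1 / real (Suc m) \<le>
        spherical_dist u (sgn (\<Sum>i\<in>{1..n}. real (k i) *\<^sub>R X i \<omega>)))" for n \<omega>
  \<comment> \<open>For \<open>n = 0\<close> the hull is empty and the criterion does not apply.
    Equivalence from 1 on is enough, because the event concerns large \<open>n\<close> only.\<close>
  have PQ: "?P \<omega> n \<longleftrightarrow> Q n \<omega>" if "\<omega> \<in> space M" "1 \<le> n" for n \<omega>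
    unfolding Q_def
    by (rule spherical_hausdorff_hull_ge_iff) (use that XH D in auto)
  have Qm: "Measurable.pred M (Q n)" for n
  proof -
    have S: "(\<lambda>\<omega>. \<Sum>i\<in>{1..n}. real (k i) *\<^sub>R X i \<omega>) \<in> borel_measurable M" for k :: "nat \<Rightarrow> nat"
      using Xm by (intro borel_measurable_sum borel_measurable_scaleR) auto
    have "(\<lambda>\<omega>. spherical_dist u (sgn (\<Sum>i\<in>{1..n}. real (k i) *\<^sub>R X i \<omega>))) \<in> borel_measurable M"
      for k :: "nat \<Rightarrow> nat" and u
      unfolding spherical_dist_def
      using S[of k] by measurable
    then have "Measurable.pred M (\<lambda>\<omega>. (\<Sum>i\<in>{1..n}. real (k i) *\<^sub>R X i \<omega>) \<noteq> 0 \<longrightarrow>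
        real n powr (- \<gamma>) - 1 / real (Suc m) \<le>
          spherical_dist u (sgn (\<Sum>i\<in>{1..n}. real (k i) *\<^sub>R X i \<omega>)))"
      for k :: "nat \<Rightarrow> nat" and u and m :: nat
      using S[of k] by measurable
    moreover have "countable (\<Pi>\<^sub>E i\<in>{1..n}. UNIV :: nat set)"
      by (rule countable_PiE) auto
    ultimately show ?thesis
      unfolding Q_def[abs_def] pred_def
      by (rule_tac sets.sets_Collect_countable_All,
          rule_tac sets.sets_Collect_countable_Ex'[OF _ D(1)],
          rule_tac sets.sets_Collect_countable_All') simp_all
  qed
  have "(\<forall>\<^sub>F n in sequentially. ?P \<omega> n) \<longleftrightarrow> (\<forall>\<^sub>F n in sequentially. Q n \<omega>)" if "\<omega> \<in> space M" for \<omega>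
    by (rule eventually_cong[OF eventually_ge_at_top[of 1]]) (use PQ[OF that] in blast)
  then have "?E = {\<omega> \<in> space M. \<exists>N. \<forall>n\<ge>N. Q n \<omega>}"
    unfolding eventually_sequentially by blast
  moreover have "{\<omega> \<in> space M. \<exists>N. \<forall>n\<ge>N. Q n \<omega>} \<in> sets M"
    using Qm by measurable
  ultimately have Em: "?E \<in> sets M"
    by (rule ssubst)

  obtain C where C: "\<And>t. 0 < t \<Longrightarrow> t \<le> 1 \<Longrightarrow>
      measure (uniform_halfsphere e) {u \<in> halfsphere e. u \<bullet> e < t} \<le> C * t"
    using uniform_halfsphere_strip_bound[OF e] by blast
  define A where "A i t = {\<omega> \<in> space M. X i \<omega> \<bullet> e < t}" for i t
  have Am: "A i t \<in> sets M" if "1 \<le> i" for i t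
    unfolding A_def using Xm[OF that] by measurable
  have PA: "measure M (A i t) \<le> C * t" if "1 \<le> i" "0 < t" "t \<le> 1" for i t
  proof -
    let ?S = "{u \<in> halfsphere e. u \<bullet> e < t}"
    have "?S = halfsphere e \<inter> {u. u \<bullet> e < t}"
      by auto
    then have S: "?S \<in> sets (uniform_halfsphere e)"
      unfolding sets_uniform_halfsphere by (auto simp: sets_restrict_space intro!: imageI)
    have "A i t = X i -` ?S \<inter> space M"
      using XH[OF that(1)] by (auto simp: A_def)
    then have "measure M (A i t) = measure (distr M (uniform_halfsphere e) (X i)) ?S"
      using measure_distr[OF Xu[OF that(1)] S] by simp
    then show ?thesis
      using C[OF that(2,3)] assms(6)[OF that(1)] by simp
  qed
  define B where "B n = (\<Union>i\<in>{1..n}. A i (real n powr (- \<gamma>)))" for n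
  have Bm: "B n \<in> sets M" for n
    unfolding B_def using Am by auto
  \<comment> \<open>For \<open>n = 0\<close> the union is empty and \<open>0 powr x\<close> is 0 by
    convention, so both sides vanish.\<close>
  have PB: "measure M (B n) \<le> C * real n powr (1 - \<gamma>)" for n
  proof (cases "n = 0")
    case False
    have "measure M (B n) \<le> (\<Sum>i\<in>{1..n}. measure M (A i (real n powr (- \<gamma>))))"
      unfolding B_def using Am by (intro finite_measure_subadditive_finite) auto
    also have "\<dots> \<le> (\<Sum>i\<in>{1..n}. C * real n powr (- \<gamma>))"
      using False assms(7) by (intro sum_mono PA) (auto simp: powr_minus_divide ge_one_powr_ge_zero)
    also have "\<dots> = C * (real n powr 1 * real n powr (- \<gamma>))"
      by simp
    also have "\<dots> = C * real n powr (1 - \<gamma>)"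
      unfolding powr_add[symmetric] by simp
    finally show ?thesis .
  qed (simp add: B_def)
  \<comment> \<open>The exponent \<open>1 - \<gamma>\<close> lies below -1 because \<gamma> >
    2.\<close>
  have "summable (\<lambda>n. C * real n powr (1 - \<gamma>))"
    using assms(7) by (intro summable_mult) (simp add: summable_real_powr_iff)
  then have "summable (\<lambda>n. measure M (B n))"
    by (rule summable_comparison_test'[where N = 0]) (use PB in simp)
  then have "AE \<omega> in M. \<forall>\<^sub>F n in sequentially. \<omega> \<in> space M - B n"
    using Bm by (intro borel_cantelli_AE1) (auto simp: less_top[symmetric])
  \<comment> \<open>Almost surely only finitely many \<open>B n\<close> occur. Off
    \<open>B n\<close> the first \<open>n\<close> points all satisfy
    \<open>X i \<omega> \<bullet> e >= n powr (- \<gamma>)\<close>, and the deterministic lower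
    bound applies with this \<open>t\<close>.\<close>
  then have "AE \<omega> in M. \<omega> \<in> ?E"
  proof (rule AE_mp, intro AE_I2 impI)
    fix \<omega> assume \<omega>: "\<omega> \<in> space M" and ev: "\<forall>\<^sub>F n in sequentially. \<omega> \<in> space M - B n"
    from ev eventually_ge_at_top[of 1] have "\<forall>\<^sub>F n in sequentially. ?P \<omega> n"
    proof eventually_elim
      case (elim n)
      show ?case
      proof (rule spherical_hausdorff_hull_ge[OF dim e])
        show "real n powr (- \<gamma>) \<le> X i \<omega> \<bullet> e" if "i \<in> {1..n}" for i
          using elim(1) \<omega> that by (force simp: B_def A_def)
      qed (use XH \<omega> elim(2) in auto)
    qed
    then show "\<omega> \<in> ?E"
      using \<omega> by simp
  qed
  \<comment> \<open>The passage from an almost sure statement to probability 1 uses the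
    measurability of the event, \<open>Em\<close>.\<close>
  then show ?thesis
    unfolding prob_eq_1[OF Em] .
qed

end
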